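(* Let $S:\operatorname{dom} S\subseteq \ell^2\to\ell^2$ be the linear operator with $$\operatorname{dom} S=\Big\{y=(y_n)_{n\ge 1}\in\ell^2 \;\Big|\; \sum_{i\ge 1}y_i=0,\ \Big(\sum_{i\le n}y_i\Big)_{n\ge 1}\in\ell^2\Big\},\qquad Sy=\Big(\sum_{i<n}y_i+\tfrac12 y_n\Big)_{n\ge 1}\quad (y\in\operatorname{dom} S).$$ Then $S$ is skew.
   Context: $\ell^2$ is the real Hilbert space of square-summable real sequences $(x_1,x_2,\dots)$ with inner product $\langle\cdot,\cdot\rangle$. Infinite series are limits of partial sums, and $\sum_{i<1}y_i=0$. A linear operator $S$ with domain $\operatorname{dom}S$ is skew if $\langle x,Sx\rangle=0$ for all $x\in\operatorname{dom}S$. *)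

theory Defs
  imports "HOL-Analysis.Analysis"
begin

(* Sequences are indexed from 0: ell2_nth x n is the entry x_(n+1) of the usual 1-based notation. *)

typedef ell2 = "{x :: nat \<Rightarrow> real. summable (\<lambda>n. (x n)\<^sup>2)}"
  morphisms ell2_nth Abs_ell2
  by (rule exI[of _ "\<lambda>_. 0"]) simp

setup_lifting type_definition_ell2

lemma summable_mult_square:
  fixes x y :: "nat \<Rightarrow> real"
  assumes "summable (\<lambda>n. (x n)\<^sup>2)" "summable (\<lambda>n. (y n)\<^sup>2)"
  shows "summable (\<lambda>n. x n * y n)"
proof (rule summable_comparison_test')
  show "summable (\<lambda>n. (x n)\<^sup>2 + (y n)\<^sup>2)"
    using assms by (rule summable_add)
  fix n :: nat
  have "0 \<le> (\<bar>x n\<bar> - \<bar>y n\<bar>)\<^sup>2" by simp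
  then have "2 * (\<bar>x n\<bar> * \<bar>y n\<bar>) \<le> (x n)\<^sup>2 + (y n)\<^sup>2"
    by (simp add: power2_diff)
  moreover have "0 \<le> \<bar>x n\<bar> * \<bar>y n\<bar>" by simp
  ultimately show "norm (x n * y n) \<le> (x n)\<^sup>2 + (y n)\<^sup>2"
    by (simp only: real_norm_def abs_mult)
qed

lemma summable_square_add:
  fixes x y :: "nat \<Rightarrow> real"
  assumes "summable (\<lambda>n. (x n)\<^sup>2)" "summable (\<lambda>n. (y n)\<^sup>2)"
  shows "summable (\<lambda>n. (x n + y n)\<^sup>2)"
  unfolding power2_sum mult.assoc
  by (intro summable_add summable_mult summable_mult_square assms)

lemma summable_square_scale:
  fixes x :: "nat \<Rightarrow> real"
  assumes "summable (\<lambda>n. (x n)\<^sup>2)"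
  shows "summable (\<lambda>n. (c * x n)\<^sup>2)"
  unfolding power_mult_distrib by (intro summable_mult assms)

instantiation ell2 :: real_inner
begin

lift_definition zero_ell2 :: ell2 is "\<lambda>_. 0" by simp

lift_definition plus_ell2 :: "ell2 \<Rightarrow> ell2 \<Rightarrow> ell2" is "\<lambda>x y n. x n + y n"
  by (rule summable_square_add)

lift_definition uminus_ell2 :: "ell2 \<Rightarrow> ell2" is "\<lambda>x n. - x n" by simp

lift_definition minus_ell2 :: "ell2 \<Rightarrow> ell2 \<Rightarrow> ell2" is "\<lambda>x y n. x n - y n"
  using summable_square_add[of _ "\<lambda>n. - _ n"] by simp

lift_definition scaleR_ell2 :: "real \<Rightarrow> ell2 \<Rightarrow> ell2" is "\<lambda>c x n. c * x n"
  by (rule summable_square_scale)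

lift_definition inner_ell2 :: "ell2 \<Rightarrow> ell2 \<Rightarrow> real" is "\<lambda>x y. \<Sum>n. x n * y n" .

definition norm_ell2 :: "ell2 \<Rightarrow> real" where "norm_ell2 x = sqrt (inner x x)"
definition dist_ell2 :: "ell2 \<Rightarrow> ell2 \<Rightarrow> real" where "dist_ell2 x y = norm (x - y)"
definition sgn_ell2 :: "ell2 \<Rightarrow> ell2" where "sgn_ell2 x = inverse (norm x) *\<^sub>R x"
definition uniformity_ell2 :: "(ell2 \<times> ell2) filter" where
  "uniformity_ell2 = (INF e\<in>{0<..}. principal {(x, y). dist x y < e})"
definition open_ell2 :: "ell2 set \<Rightarrow> bool" where
  "open_ell2 U \<longleftrightarrow> (\<forall>x\<in>U. eventually (\<lambda>(x', y). x' = x \<longrightarrow> y \<in> U) uniformity)"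

instance
proof
  fix x y z :: ell2 and a b :: real and U :: "ell2 set"
  show "x + y + z = x + (y + z)" by transfer (simp add: add.assoc)
  show "x + y = y + x" by transfer (simp add: add.commute)
  show "0 + x = x" by transfer simp
  show "- x + x = 0" by transfer simp
  show "x - y = x + - y" by transfer simp
  show "a *\<^sub>R (x + y) = a *\<^sub>R x + a *\<^sub>R y" by transfer (simp add: algebra_simps)
  show "(a + b) *\<^sub>R x = a *\<^sub>R x + b *\<^sub>R x" by transfer (simp add: algebra_simps)
  show "a *\<^sub>R b *\<^sub>R x = (a * b) *\<^sub>R x" by transfer (simp add: algebra_simps)
  show "1 *\<^sub>R x = x" by transfer simp
  show "dist x y = norm (x - y)" by (rule dist_ell2_def)
  show "sgn x = inverse (norm x) *\<^sub>R x" by (rule sgn_ell2_def)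
  show "norm x = sqrt (inner x x)" by (rule norm_ell2_def)
  show "(uniformity :: (ell2 \<times> ell2) filter) = (INF e\<in>{0<..}. principal {(x, y). dist x y < e})"
    by (rule uniformity_ell2_def)
  show "open U \<longleftrightarrow> (\<forall>x\<in>U. eventually (\<lambda>(x', y). x' = x \<longrightarrow> y \<in> U) uniformity)"
    by (rule open_ell2_def)
  show "inner x y = inner y x" by transfer (simp add: mult.commute)
  show "inner (x + y) z = inner x z + inner y z"
    by transfer (simp add: distrib_right suminf_add summable_mult_square)
  show "inner (a *\<^sub>R x) y = a * inner x y"
    by transfer (simp add: mult.assoc suminf_mult summable_mult_square)
  show "0 \<le> inner x x"
    by transfer (simp add: suminf_nonneg power2_eq_square)
  show "inner x x = 0 \<longleftrightarrow> x = 0"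
    by transfer (auto simp: suminf_eq_zero_iff power2_eq_square)
qed

end

(* A partially defined operator is a total HOL function S together with a domain D, which must be
   a linear subspace; the values of S off D are irrelevant. *)

definition linear_operator_on :: "'a::real_vector set \<Rightarrow> ('a \<Rightarrow> 'b::real_vector) \<Rightarrow> bool" where
  "linear_operator_on D S \<longleftrightarrow> subspace D \<and>
     (\<forall>x\<in>D. \<forall>y\<in>D. S (x + y) = S x + S y) \<and> (\<forall>c. \<forall>x\<in>D. S (c *\<^sub>R x) = c *\<^sub>R S x)"

definition skew_on :: "'a::real_inner set \<Rightarrow> ('a \<Rightarrow> 'a) \<Rightarrow> bool" where
  "skew_on D S \<longleftrightarrow> linear_operator_on D S \<and> (\<forall>x\<in>D. inner x (S x) = 0)"

definition dom_S :: "ell2 set" where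
  "dom_S = {y. ell2_nth y sums 0 \<and> summable (\<lambda>n. (\<Sum>i\<le>n. ell2_nth y i)\<^sup>2)}"

(* Abs_ell2 is meaningful only on square-summable sequences; ell2_nth_op_S below shows that this is
   the case for every y in dom_S. *)

definition op_S :: "ell2 \<Rightarrow> ell2" where
  "op_S y = Abs_ell2 (\<lambda>n. (\<Sum>i<n. ell2_nth y i) + 1/2 * ell2_nth y n)"

lemma ell2_nth_op_S:
  assumes "y \<in> dom_S"
  shows "ell2_nth (op_S y) = (\<lambda>n. (\<Sum>i<n. ell2_nth y i) + 1/2 * ell2_nth y n)"
proof -
  have y: "summable (\<lambda>n. (ell2_nth y n)\<^sup>2)"
    using ell2_nth[of y] by simp
  have s: "summable (\<lambda>n. (\<Sum>i\<le>n. ell2_nth y i)\<^sup>2)"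
    using assms by (simp add: dom_S_def)
  have "(\<Sum>i\<le>n. ell2_nth y i) + (- 1/2) * ell2_nth y n
      = (\<Sum>i<n. ell2_nth y i) + 1/2 * ell2_nth y n" for n
    by (simp flip: lessThan_Suc_atMost)
  then have "summable (\<lambda>n. ((\<Sum>i<n. ell2_nth y i) + 1/2 * ell2_nth y n)\<^sup>2)"
    using summable_square_add[OF s summable_square_scale[OF y, of "- 1/2"]] by (simp only: simp_thms)
  then show ?thesis
    unfolding op_S_def by (simp add: Abs_ell2_inverse)
qed

end

theory Submission
  imports Defs
begin

text \<open>
  Let \<open>s n\<close> be the sum of the first \<open>n\<close> entries of \<open>y\<close>. The entry \<open>n\<close> of \<open>y\<close> is the increment
  \<open>s (n + 1) - s n\<close>, and the weight one half on the diagonal makes the entry \<open>n\<close> of \<open>S y\<close> the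
  midpoint \<open>(s n + s (n + 1)) / 2\<close>. The product of the two is half of \<open>(s (n + 1))\<^sup>2 - (s n)\<^sup>2\<close>, so
  the series of the inner product of \<open>y\<close> and \<open>S y\<close> telescopes. Its value is half of the limit of
  \<open>(s n)\<^sup>2\<close>, which vanishes because \<open>y\<close> sums to zero.

  The domain is closed under addition and scaling because convergence of series and
  square-summability are, and \<open>S\<close> is linear there because partial sums depend linearly on the
  sequence.
\<close>

lemma subspace_dom_S: "subspace dom_S"
proof (rule subspaceI)
  show "0 \<in> dom_S"
    by (simp add: dom_S_def zero_ell2.rep_eq)
next
  fix x y assume "x \<in> dom_S" "y \<in> dom_S"
  then show "x + y \<in> dom_S"
    using sums_add[of "ell2_nth x" 0 "ell2_nth y" 0]
    by (simp add: dom_S_def plus_ell2.rep_eq sum.distrib summable_square_add)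
next
  fix c :: real and x assume "x \<in> dom_S"
  then show "c *\<^sub>R x \<in> dom_S"
    using sums_mult[of "ell2_nth x" 0 c]
    by (simp add: dom_S_def scaleR_ell2.rep_eq summable_square_scale flip: sum_distrib_left)
qed

lemma linear_operator_on_dom_S: "linear_operator_on dom_S op_S"
  unfolding linear_operator_on_def
proof (intro conjI ballI allI)
  show "subspace dom_S" by (rule subspace_dom_S)
next
  fix x y assume "x \<in> dom_S" "y \<in> dom_S"
  then have "ell2_nth (op_S (x + y)) = ell2_nth (op_S x + op_S y)"
    using subspace_add[OF subspace_dom_S]
    by (simp add: ell2_nth_op_S plus_ell2.rep_eq sum.distrib add_divide_distrib add_ac)
  then show "op_S (x + y) = op_S x + op_S y" by (simp add: ell2_nth_inject)
next
  fix c :: real and x assume "x \<in> dom_S"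
  then have "ell2_nth (op_S (c *\<^sub>R x)) = ell2_nth (c *\<^sub>R op_S x)"
    using subspace_scale[OF subspace_dom_S]
    by (simp add: ell2_nth_op_S scaleR_ell2.rep_eq distrib_left flip: sum_distrib_left)
  then show "op_S (c *\<^sub>R x) = c *\<^sub>R op_S x" by (simp add: ell2_nth_inject)
qed

text \<open>
  Each term is half the increment of the squared partial sums, so the series telescopes to half the
  square of \<open>l\<close>.
\<close>

lemma sums_mult_midpoint_partial_sum:
  fixes y :: "nat \<Rightarrow> real"
  assumes "y sums l"
  shows "(\<lambda>n. y n * ((\<Sum>i<n. y i) + 1/2 * y n)) sums (l\<^sup>2 / 2)"
proof -
  let ?q = "\<lambda>n. (\<Sum>i<n. y i)\<^sup>2 / 2"
  have "?q \<longlonglongrightarrow> l\<^sup>2 / 2"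
    using assms unfolding sums_def by (intro tendsto_intros) auto
  then have "(\<lambda>n. ?q (Suc n) - ?q n) sums (l\<^sup>2 / 2 - ?q 0)"
    by (rule telescope_sums)
  moreover have "?q (Suc n) - ?q n = y n * ((\<Sum>i<n. y i) + 1/2 * y n)" for n
    by (simp add: power2_eq_square field_simps)
  ultimately show ?thesis by simp
qed

theorem proposition3p2:
  shows "skew_on dom_S op_S"
  unfolding skew_on_def
proof (intro conjI ballI)
  show "linear_operator_on dom_S op_S" by (rule linear_operator_on_dom_S)
next
  fix y assume y: "y \<in> dom_S"
  then have "ell2_nth y sums 0" by (simp add: dom_S_def)
  from sums_mult_midpoint_partial_sum[OF this] show "inner y (op_S y) = 0"
    by (simp add: inner_ell2.rep_eq ell2_nth_op_S[OF y] sums_iff)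
qed

end
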